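(* Let $X$ be a topological vector space which has no quotients isomorphic to $\varphi$. Then there are no cyclic operators with dense range on $X\times\varphi$.
   Context: All vector spaces are over $\mathbb K$, which is either $\mathbb R$ or $\mathbb C$; all topological spaces are Hausdorff; topological vector spaces are non-trivial ($\neq\{0\}$) and are not assumed locally convex unless said so. A quotient of a topological vector space $X$ is a space $X/Y$, where $Y$ is a closed linear subspace of $X$. "Operator" means continuous linear operator. $\mathbb Z_+$ is the set of non-negative integers. $\varphi$ is the locally convex direct sum of countably infinitely many copies of $\mathbb K$, i.e. a vector space of countably infinite algebraic dimension with its strongest locally convex topology. A continuous linear operator $T$ on a topological vector space $Z$ is cyclic if there is $z\in Z$ such that $\mathrm{span}\{T^nz:n\in\mathbb Z_+\}$ is dense in $Z$. *)

theory Defs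
  imports "HOL-Analysis.Analysis" "HOL-Library.Poly_Mapping"
begin

text \<open>A space lives on a whole type; its scalar multiplication and its topology are explicit, since
  the same vector space carries several topologies below and the scalar field is
  \<^typ>\<open>real\<close> or \<^typ>\<open>complex\<close>.  The class \<open>real_normed_field\<close> only serves to treat both fields
  with the same definitions.\<close>

locale topological_vector_space = vector_space s
  for s :: "'k::real_normed_field \<Rightarrow> 'a::ab_group_add \<Rightarrow> 'a" +
  fixes T :: "'a topology"
  assumes topspace_eq: "topspace T = UNIV"
    and hausdorff: "Hausdorff_space T"
    and nontrivial: "\<exists>x::'a. x \<noteq> 0"
    and continuous_add: "continuous_map (prod_topology T T) T (\<lambda>(x, y). x + y)"
    and continuous_scale: "continuous_map (prod_topology euclidean T) T (\<lambda>(c, x). s c x)"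

definition convex_set :: "('k::real_normed_field \<Rightarrow> 'a::ab_group_add \<Rightarrow> 'a) \<Rightarrow> 'a set \<Rightarrow> bool" where
  "convex_set s V \<longleftrightarrow>
     (\<forall>x\<in>V. \<forall>y\<in>V. \<forall>t::real. 0 \<le> t \<and> t \<le> 1 \<longrightarrow>
        s (of_real (1 - t)) x + s (of_real t) y \<in> V)"

locale locally_convex_space = topological_vector_space s T
  for s :: "'k::real_normed_field \<Rightarrow> 'a::ab_group_add \<Rightarrow> 'a" and T :: "'a topology" +
  assumes convex_base:
    "openin T U \<Longrightarrow> 0 \<in> U \<Longrightarrow> \<exists>V. openin T V \<and> 0 \<in> V \<and> V \<subseteq> U \<and> convex_set s V"

definition prod_scale ::
    "('k \<Rightarrow> 'a \<Rightarrow> 'a) \<Rightarrow> ('k \<Rightarrow> 'b \<Rightarrow> 'b) \<Rightarrow> 'k \<Rightarrow> 'a \<times> 'b \<Rightarrow> 'a \<times> 'b" where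
  "prod_scale s1 s2 c = (\<lambda>(x, y). (s1 c x, s2 c y))"

lemma vector_space_prod:
  "vector_space s1 \<Longrightarrow> vector_space s2 \<Longrightarrow> vector_space (prod_scale s1 s2)"
  by (auto simp: vector_space_def prod_scale_def)


subsection \<open>The space \<open>\<phi>\<close>\<close>

text \<open>The underlying vector space of \<open>\<phi>\<close> consists of the finitely supported sequences of scalars.\<close>

definition phi_scale :: "'k::real_normed_field \<Rightarrow> (nat \<Rightarrow>\<^sub>0 'k) \<Rightarrow> (nat \<Rightarrow>\<^sub>0 'k)" where
  "phi_scale c = Poly_Mapping.map ((*) c)"

text \<open>The supremum of all locally convex topologies.  Lemma \<open>locally_convex_space_phi\<close> below
  shows that it is itself locally convex, hence the strongest such topology.\<close>

definition phi_topology :: "(nat \<Rightarrow>\<^sub>0 'k::real_normed_field) topology" where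
  "phi_topology =
     topology_generated_by {U. \<exists>S. locally_convex_space phi_scale S \<and> openin S U}"

lemma lookup_phi_scale [simp]: "Poly_Mapping.lookup (phi_scale c f) n = c * Poly_Mapping.lookup f n"
  by (simp add: phi_scale_def Poly_Mapping.map.rep_eq when_def)

lemma vector_space_phi: "vector_space phi_scale"
  by unfold_locales (auto intro!: poly_mapping_eqI simp: lookup_add algebra_simps)

lemma locally_convex_space_phi_product:
  "locally_convex_space (phi_scale :: 'k::real_normed_field \<Rightarrow> _)
     (pullback_topology UNIV Poly_Mapping.lookup (product_topology (\<lambda>_. euclidean) UNIV))"
  (is "locally_convex_space _ ?P")
proof -
  let ?E = "product_topology (\<lambda>_::nat. euclidean :: 'k topology) UNIV"
  have top: "topspace ?P = UNIV"
    by (auto simp: topspace_pullback_topology)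
  have lk: "continuous_map ?P euclidean (\<lambda>f. Poly_Mapping.lookup f n)" for n
  proof -
    have "continuous_map ?P euclidean ((\<lambda>x. x n) \<circ> Poly_Mapping.lookup)"
      by (rule continuous_map_pullback) (auto intro: continuous_map_product_projection)
    then show ?thesis by (simp add: o_def)
  qed
  have into: "continuous_map X ?P g"
    if "\<And>n. continuous_map X euclidean (\<lambda>x. Poly_Mapping.lookup (g x) n)" for X and g :: "'b \<Rightarrow> _"
    by (rule continuous_map_pullback')
       (use that in \<open>auto simp: continuous_map_componentwise o_def\<close>)
  have sub: "topological_vector_space (phi_scale :: 'k \<Rightarrow> _) ?P"
  proof (intro topological_vector_space.intro topological_vector_space_axioms.intro vector_space_phi)
    show "Hausdorff_space ?P"
      unfolding Hausdorff_space_def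
    proof clarify
      fix x y :: "nat \<Rightarrow>\<^sub>0 'k" assume "x \<noteq> y"
      then obtain n where n: "Poly_Mapping.lookup x n \<noteq> Poly_Mapping.lookup y n"
        by (auto simp: poly_mapping_eq_iff fun_eq_iff)
      then obtain U V where UV: "open U" "open V" "Poly_Mapping.lookup x n \<in> U"
          "Poly_Mapping.lookup y n \<in> V" "U \<inter> V = {}"
        using hausdorff[OF n] by blast
      let ?f = "\<lambda>W. {z \<in> topspace ?P. Poly_Mapping.lookup z n \<in> W}"
      have "openin ?P (?f U)" "openin ?P (?f V)"
        by (rule openin_continuous_map_preimage[OF lk]; simp add: UV)+
      moreover have "x \<in> ?f U" "y \<in> ?f V" "disjnt (?f U) (?f V)"
        using UV top by (auto simp: disjnt_iff)
      ultimately show "\<exists>U V. openin ?P U \<and> openin ?P V \<and> x \<in> U \<and> y \<in> V \<and> disjnt U V"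
        by blast
    qed
    show "\<exists>x::nat \<Rightarrow>\<^sub>0 'k. x \<noteq> 0"
      by (metis lookup_single_eq lookup_zero zero_neq_one)
    show "continuous_map (prod_topology ?P ?P) ?P (\<lambda>(x, y). x + y)"
    proof (rule into)
      fix n
      have "continuous_map (prod_topology ?P ?P) euclidean
              (\<lambda>z. Poly_Mapping.lookup (fst z) n + Poly_Mapping.lookup (snd z) n)"
        by (intro continuous_map_add continuous_map_compose[OF continuous_map_fst lk, unfolded o_def]
             continuous_map_compose[OF continuous_map_snd lk, unfolded o_def])
      then show "continuous_map (prod_topology ?P ?P) euclidean
              (\<lambda>z. Poly_Mapping.lookup (case z of (x, y) \<Rightarrow> x + y) n)"
        by (simp add: case_prod_unfold lookup_add)
    qed
    show "continuous_map (prod_topology euclidean ?P) ?P (\<lambda>(c, x). phi_scale c x)"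
    proof (rule into)
      fix n
      have *: "continuous_map (prod_topology euclidean euclidean) euclidean (\<lambda>z::'k\<times>'k. fst z * snd z)"
        by (auto simp: euclidean_product_topology intro!: continuous_intros)
      have "continuous_map (prod_topology euclidean ?P) (prod_topology euclidean euclidean)
              (\<lambda>z. (fst z, Poly_Mapping.lookup (snd z) n))"
        by (intro continuous_map_pairedI continuous_map_fst
             continuous_map_compose[OF continuous_map_snd lk, unfolded o_def])
      from continuous_map_compose[OF this *]
      show "continuous_map (prod_topology euclidean ?P) euclidean
              (\<lambda>z. Poly_Mapping.lookup (case z of (c, x) \<Rightarrow> phi_scale c x) n)"
        by (simp add: case_prod_unfold o_def)
    qed
  qed (rule top)
  show ?thesis
  proof (intro locally_convex_space.intro sub locally_convex_space_axioms.intro)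
    fix U assume U: "openin ?P U" "0 \<in> U"
    then obtain W :: "(nat \<Rightarrow> 'k) set" where W: "openin ?E W" "U = Poly_Mapping.lookup -` W"
      by (auto simp: openin_pullback_topology)
    then have W0: "(\<lambda>_. 0) \<in> W" using U by (auto simp: zero_poly_mapping.rep_eq)
    obtain B :: "nat \<Rightarrow> 'k set" where B: "finite {i. B i \<noteq> UNIV}" "\<And>i. open (B i)" "(\<lambda>_. 0) \<in> Pi\<^sub>E UNIV B"
        "Pi\<^sub>E UNIV B \<subseteq> W"
      using product_topology_open_contains_basis[OF W(1) W0] by auto
    have "\<exists>e>0. ball 0 e \<subseteq> B i" for i
      using B(2,3) by (auto simp: open_contains_ball PiE_iff)
    then obtain e where e: "\<And>i. e i > 0" "\<And>i. ball 0 (e i) \<subseteq> B i" by metis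
    define C :: "nat \<Rightarrow> 'k set" where "C i = (if B i = UNIV then UNIV else ball 0 (e i))" for i
    have Cc: "convex (C i)" and Co: "open (C i)" and C0: "0 \<in> C i" and CB: "C i \<subseteq> B i" for i
      using e by (auto simp: C_def)
    have "openin ?E (Pi\<^sub>E UNIV C)"
    proof (rule product_topology_basis)
      show "finite {i. C i \<noteq> topspace euclidean}"
        by (rule finite_subset[OF _ B(1)]) (auto simp: C_def)
    qed (use Co in auto)
    then have 1: "openin ?P (Poly_Mapping.lookup -` Pi\<^sub>E UNIV C)"
      by (auto simp: openin_pullback_topology)
    have 2: "convex_set phi_scale (Poly_Mapping.lookup -` Pi\<^sub>E UNIV C)"
      unfolding convex_set_def
    proof (clarsimp simp: PiE_iff lookup_add)
      fix x y t n assume "\<forall>i. Poly_Mapping.lookup x i \<in> C i" "\<forall>i. Poly_Mapping.lookup y i \<in> C i"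
        "0 \<le> (t::real)" "t \<le> 1"
      then show "(1 - of_real t) * Poly_Mapping.lookup x n + of_real t * Poly_Mapping.lookup y n \<in> C n"
        using convexD_alt[OF Cc, of "Poly_Mapping.lookup x n" n "Poly_Mapping.lookup y n" t]
        by (simp add: scaleR_conv_of_real)
    qed
    show "\<exists>V. openin ?P V \<and> 0 \<in> V \<and> V \<subseteq> U \<and> convex_set phi_scale V"
      using 1 2 C0 CB B(4) W(2) by (intro exI[of _ "Poly_Mapping.lookup -` Pi\<^sub>E UNIV C"])
        (force simp: PiE_iff)
  qed
qed

lemma openin_phi_topology:
  "locally_convex_space phi_scale S \<Longrightarrow> openin S U \<Longrightarrow> openin phi_topology U"
  unfolding phi_topology_def by (auto intro: topology_generated_by_Basis)

lemma locally_convex_space_phi: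
  "locally_convex_space phi_scale (phi_topology :: (nat \<Rightarrow>\<^sub>0 'k::real_normed_field) topology)"
proof -
  let ?T = "phi_topology :: (nat \<Rightarrow>\<^sub>0 'k) topology"
  obtain S0 :: "(nat \<Rightarrow>\<^sub>0 'k) topology" where S0: "locally_convex_space phi_scale S0"
    using locally_convex_space_phi_product by blast
  interpret S0: locally_convex_space phi_scale S0 by (rule S0)
  have top: "topspace ?T = UNIV"
    using openin_phi_topology[OF S0 openin_topspace] openin_subset S0.topspace_eq by fastforce
  have un: "\<Union>{U :: (nat \<Rightarrow>\<^sub>0 'k) set. \<exists>S. locally_convex_space phi_scale S \<and> openin S U} = UNIV"
    using S0 S0.topspace_eq openin_topspace by (metis (mono_tags, lifting) CollectI UNIV_eq_I UNIV_I UnionI)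
  have mono: "continuous_map (prod_topology X ?T) S f"
    if "continuous_map (prod_topology X S) S f" "locally_convex_space phi_scale S"
    for X :: "'b topology" and S :: "(nat \<Rightarrow>\<^sub>0 'k) topology" and f
  proof -
    have "continuous_map ?T S id"
      using openin_phi_topology[OF that(2)] that(2)
      by (auto simp: continuous_map_def top locally_convex_space_def topological_vector_space_def
          topological_vector_space_axioms_def)
    then have "continuous_map (prod_topology X ?T) (prod_topology X S) (\<lambda>z. (fst z, snd z))"
      by (intro continuous_map_pairedI continuous_map_fst)
         (metis continuous_map_compose continuous_map_snd id_comp)
    from continuous_map_compose[OF this that(1)] show ?thesis by (simp add: o_def)
  qed
  have gen: "continuous_map X ?T f"
    if "\<And>S. locally_convex_space phi_scale S \<Longrightarrow> continuous_map X S f"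
    for X :: "'b topology" and f
    unfolding phi_topology_def
  proof (rule continuous_on_generated_topo)
    fix U assume "U \<in> {U :: (nat \<Rightarrow>\<^sub>0 'k) set. \<exists>S. locally_convex_space phi_scale S \<and> openin S U}"
    then show "openin X (f -` U \<inter> topspace X)"
      using that by (auto simp: continuous_map_alt)
  qed (use un in auto)
  have sub: "topological_vector_space (phi_scale :: 'k \<Rightarrow> _) ?T"
  proof (intro topological_vector_space.intro topological_vector_space_axioms.intro vector_space_phi)
    show "Hausdorff_space ?T"
      using S0.hausdorff openin_phi_topology[OF S0] unfolding Hausdorff_space_def S0.topspace_eq top by metis
    show "continuous_map (prod_topology ?T ?T) ?T (\<lambda>(x, y). x + y)"
    proof (rule gen)
      fix S :: "(nat \<Rightarrow>\<^sub>0 'k) topology" assume S: "locally_convex_space phi_scale S"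
      then interpret S: locally_convex_space phi_scale S .
      have 1: "continuous_map (prod_topology S ?T) S (\<lambda>(x, y). x + y)"
        by (rule mono[OF S.continuous_add S])
      have id: "continuous_map ?T S (\<lambda>x. x)"
        using openin_phi_topology[OF S] by (auto simp: continuous_map_def top S.topspace_eq)
      have "continuous_map (prod_topology ?T ?T) (prod_topology S ?T) (\<lambda>z. (fst z, snd z))"
        by (intro continuous_map_pairedI continuous_map_snd
             continuous_map_compose[OF continuous_map_fst id, unfolded o_def])
      from continuous_map_compose[OF this 1]
      show "continuous_map (prod_topology ?T ?T) S (\<lambda>(x, y). x + y)" by (simp add: o_def)
    qed
    show "continuous_map (prod_topology euclidean ?T) ?T (\<lambda>(c, x). phi_scale c x)"
    proof (rule gen)
      fix S :: "(nat \<Rightarrow>\<^sub>0 'k) topology" assume S: "locally_convex_space phi_scale S"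
      then interpret S: locally_convex_space phi_scale S .
      show "continuous_map (prod_topology euclidean ?T) S (\<lambda>(c, x). phi_scale c x)"
        by (rule mono[OF S.continuous_scale S])
    qed
  qed (use top S0.nontrivial in auto)
  show "locally_convex_space (phi_scale :: 'k \<Rightarrow> _) ?T"
  proof (intro locally_convex_space.intro sub locally_convex_space_axioms.intro)
    fix U assume "openin ?T U" "0 \<in> U"
    then have "generate_topology_on
        {U :: (nat \<Rightarrow>\<^sub>0 'k) set. \<exists>S. locally_convex_space phi_scale S \<and> openin S U} U"
      by (simp add: phi_topology_def openin_topology_generated_by)
    then show "\<exists>V. openin ?T V \<and> 0 \<in> V \<and> V \<subseteq> U \<and> convex_set phi_scale V"
      using \<open>0 \<in> U\<close>
    proof induction
      case Empty
      then show ?case by simp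
    next
      case (Int a b)
      then obtain V W where "openin ?T V \<and> 0 \<in> V \<and> V \<subseteq> a \<and> convex_set phi_scale V"
        "openin ?T W \<and> 0 \<in> W \<and> W \<subseteq> b \<and> convex_set phi_scale W" by blast
      then show ?case
        by (intro exI[of _ "V \<inter> W"]) (auto simp: convex_set_def)
    next
      case (UN K)
      from UN.prems obtain k where k: "k \<in> K" "0 \<in> k" by blast
      from UN.IH[OF this] show ?case using k(1) by blast
    next
      case (Basis s)
      then obtain S where S: "locally_convex_space phi_scale S" "openin S s" by blast
      then obtain V where "openin S V" "0 \<in> V" "V \<subseteq> s" "convex_set phi_scale V"
        using locally_convex_space.convex_base[OF S Basis.prems] by blast
      then show ?case using openin_phi_topology[OF S(1)] by blast
    qed
  qed
qed


subsection \<open>Quotients\<close>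

text \<open>The quotient by a linear subspace \<open>Y\<close> consists of the cosets of \<open>Y\<close>; its zero is \<open>Y\<close>.
  In \<open>quotient_scale\<close> the summand from \<open>Y\<close> makes the product with the scalar 0 a coset as well.\<close>

definition left_coset :: "'a::ab_group_add set \<Rightarrow> 'a \<Rightarrow> 'a set" where
  "left_coset Y x = {x + y | y. y \<in> Y}"

definition quotient_carrier :: "'a::ab_group_add set \<Rightarrow> 'a set set" where
  "quotient_carrier Y = range (left_coset Y)"

definition quotient_add :: "'a::ab_group_add set \<Rightarrow> 'a set \<Rightarrow> 'a set" where
  "quotient_add A B = {a + b | a b. a \<in> A \<and> b \<in> B}"

definition quotient_scale ::
    "('k \<Rightarrow> 'a::ab_group_add \<Rightarrow> 'a) \<Rightarrow> 'a set \<Rightarrow> 'k \<Rightarrow> 'a set \<Rightarrow> 'a set" where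
  "quotient_scale s Y c A = {s c a + y | a y. a \<in> A \<and> y \<in> Y}"

definition quotient_topology :: "'a::ab_group_add topology \<Rightarrow> 'a set \<Rightarrow> 'a set topology" where
  "quotient_topology T Y =
     topology (\<lambda>\<U>. \<U> \<subseteq> quotient_carrier Y \<and> openin T {x \<in> topspace T. left_coset Y x \<in> \<U>})"

lemma openin_quotient_topology:
  "openin (quotient_topology T Y) \<U> \<longleftrightarrow>
     \<U> \<subseteq> quotient_carrier Y \<and> openin T {x \<in> topspace T. left_coset Y x \<in> \<U>}"
proof -
  have "istopology (\<lambda>\<U>. \<U> \<subseteq> quotient_carrier Y \<and> openin T {x \<in> topspace T. left_coset Y x \<in> \<U>})"
    unfolding istopology_def
  proof (intro conjI allI impI)
    fix \<U> \<V> assume *: "\<U> \<subseteq> quotient_carrier Y \<and> openin T {x \<in> topspace T. left_coset Y x \<in> \<U>}"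
      "\<V> \<subseteq> quotient_carrier Y \<and> openin T {x \<in> topspace T. left_coset Y x \<in> \<V>}"
    have "{x \<in> topspace T. left_coset Y x \<in> \<U> \<inter> \<V>} =
        {x \<in> topspace T. left_coset Y x \<in> \<U>} \<inter> {x \<in> topspace T. left_coset Y x \<in> \<V>}" by auto
    with * show "openin T {x \<in> topspace T. left_coset Y x \<in> \<U> \<inter> \<V>}" by auto
  next
    fix \<K> assume *: "\<forall>\<U>\<in>\<K>. \<U> \<subseteq> quotient_carrier Y \<and> openin T {x \<in> topspace T. left_coset Y x \<in> \<U>}"
    have "{x \<in> topspace T. left_coset Y x \<in> \<Union>\<K>} =
        (\<Union>\<U>\<in>\<K>. {x \<in> topspace T. left_coset Y x \<in> \<U>})" by auto
    with * show "openin T {x \<in> topspace T. left_coset Y x \<in> \<Union>\<K>}" by auto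
  qed auto
  then show ?thesis by (simp add: quotient_topology_def)
qed

lemma quotient_map_left_coset:
  assumes "topspace T = UNIV"
  shows "quotient_map T (quotient_topology T Y) (left_coset Y)"
proof -
  have "openin (quotient_topology T Y) (quotient_carrier Y)"
    using assms openin_topspace[of T] by (auto simp: openin_quotient_topology quotient_carrier_def)
  then have "topspace (quotient_topology T Y) = quotient_carrier Y"
    by (meson openin_quotient_topology openin_subset openin_topspace subset_antisym)
  then show ?thesis
    using assms by (auto simp: quotient_map_def openin_quotient_topology quotient_carrier_def)
qed

definition quotient_isomorphic ::
    "('k::real_normed_field \<Rightarrow> 'a::ab_group_add \<Rightarrow> 'a) \<Rightarrow> 'a topology \<Rightarrow> 'a set \<Rightarrow>
     ('k \<Rightarrow> 'b::ab_group_add \<Rightarrow> 'b) \<Rightarrow> 'b topology \<Rightarrow> bool" where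
  "quotient_isomorphic s T Y s' T' \<longleftrightarrow>
     (\<exists>h. homeomorphic_map (quotient_topology T Y) T' h \<and>
          (\<forall>A\<in>quotient_carrier Y. \<forall>B\<in>quotient_carrier Y. h (quotient_add A B) = h A + h B) \<and>
          (\<forall>c. \<forall>A\<in>quotient_carrier Y. h (quotient_scale s Y c A) = s' c (h A)))"

definition has_quotient_isomorphic_to ::
    "('k::real_normed_field \<Rightarrow> 'a::ab_group_add \<Rightarrow> 'a) \<Rightarrow> 'a topology \<Rightarrow>
     ('k \<Rightarrow> 'b::ab_group_add \<Rightarrow> 'b) \<Rightarrow> 'b topology \<Rightarrow> bool" where
  "has_quotient_isomorphic_to s T s' T' \<longleftrightarrow>
     (\<exists>Y. module.subspace s Y \<and> closedin T Y \<and> quotient_isomorphic s T Y s' T')"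


subsection \<open>Operators\<close>

definition continuous_operator ::
    "('k::field \<Rightarrow> 'a::ab_group_add \<Rightarrow> 'a) \<Rightarrow> 'a topology \<Rightarrow> ('a \<Rightarrow> 'a) \<Rightarrow> bool" where
  "continuous_operator s T f \<longleftrightarrow> Vector_Spaces.linear s s f \<and> continuous_map T T f"

definition cyclic_operator ::
    "('k::field \<Rightarrow> 'a::ab_group_add \<Rightarrow> 'a) \<Rightarrow> 'a topology \<Rightarrow> ('a \<Rightarrow> 'a) \<Rightarrow> bool" where
  "cyclic_operator s T f \<longleftrightarrow>
     continuous_operator s T f \<and>
     (\<exists>z. T closure_of (module.span s (range (\<lambda>n. (f ^^ n) z))) = topspace T)"

definition dense_range :: "'a topology \<Rightarrow> ('a \<Rightarrow> 'a) \<Rightarrow> bool" where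
  "dense_range T f \<longleftrightarrow> T closure_of (f ` topspace T) = topspace T"

end

theory Submission
  imports Defs
begin

text \<open>A linear map from \<open>\<phi>\<close> to any topological vector space is continuous, so a continuous
  linear surjection \<open>X \<rightarrow> \<phi>\<close> has a continuous right inverse and exhibits \<open>\<phi>\<close> as a quotient of
  \<open>X\<close>.  If \<open>X\<close> has no such quotient, every continuous linear map \<open>X \<rightarrow> \<phi>\<close> therefore has finite
  rank.

  Now let \<open>f\<close> be an operator on \<open>X \<times> \<phi>\<close> with cyclic vector \<open>z\<close>, and let \<open>u\<^sub>n\<close> be the
  \<open>\<phi>\<close>-component of \<open>f\<^sup>n z\<close>.  Then \<open>u\<^sub>n\<^sub>+\<^sub>1 - D u\<^sub>n\<close> lies in a fixed
  finite-dimensional subspace, where \<open>D\<close> is the \<open>\<phi>\<close>-\<open>\<phi>\<close> block of \<open>f\<close>.  If \<open>f\<close> also has dense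
  range, each tail \<open>u\<^sub>k, u\<^sub>k\<^sub>+\<^sub>1, \<dots>\<close> spans \<open>\<phi>\<close>, because a functional killing the tail pulls back
  to one on \<open>X \<times> \<phi>\<close> that vanishes.  On the other hand, \<open>D\<close> eventually acts injectively between
  the successive quotients of the Krylov filtration of a finite-dimensional subspace containing the
  perturbations.  So once \<open>u\<^sub>n\<close> is at a high level of this filtration, the level increases by exactly
  one at each step, and the span of the tail misses the lower levels.\<close>

section \<open>Linear algebra: Krylov filtrations and perturbed orbits\<close>

context vector_space
begin

text \<open>Extend a basis of \<open>J\<close> to one of \<open>K\<close>, the vectors of
  \<open>span A\<close> that \<open>D\<close> keeps in \<open>span A\<close>, and then to one of
  \<open>span A\<close>. When the image of \<open>A\<close> is adjoined, only basis vectors outside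
  \<open>K\<close> can add to the dimension. With \<open>J\<close> the preceding stage of a
  filtration, this says that dimension increments never grow, and that they drop when
  \<open>J\<close> is smaller than \<open>K\<close>.\<close>

lemma dim_span_Un_image_le:
  assumes D: "Vector_Spaces.linear scale scale D" and A: "finite A"
    and J: "subspace J" "J \<subseteq> span A" "D ` J \<subseteq> span A"
  shows "dim (span (A \<union> D ` A)) + dim J \<le> 2 * dim (span A)"
    and "\<exists>v\<in>span A. D v \<in> span A \<and> v \<notin> J \<Longrightarrow>
      dim (span (A \<union> D ` A)) + dim J < 2 * dim (span A)"
proof -
  interpret D: Vector_Spaces.linear scale scale D by (rule D)
  define K where "K = {v \<in> span A. D v \<in> span A}"
  have JK: "J \<subseteq> K" using J by (auto simp: K_def)
  obtain BJ where BJ: "BJ \<subseteq> J" "independent BJ" "J \<subseteq> span BJ"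
    using maximal_independent_subset by blast
  obtain BK where BK: "BJ \<subseteq> BK" "BK \<subseteq> K" "independent BK" "K \<subseteq> span BK"
    using maximal_independent_subset_extend[of BJ K] BJ JK by blast
  obtain B where B: "BK \<subseteq> B" "B \<subseteq> span A" "independent B" "span A \<subseteq> span B"
    using maximal_independent_subset_extend[of BK "span A"] BK K_def by blast
  have fB: "finite B" using independent_span_bound[OF A B(3,2)] by blast
  then have fin: "finite BK" "finite BJ" using B(1) BK(1) by (auto intro: finite_subset)
  have spB: "span B = span A"
    using B by (simp add: span_minimal subset_antisym)
  have dims: "dim J = card BJ" "dim (span A) = card B"
    using basis_card_eq_dim BJ B by metis+
  have "D a \<in> span (B \<union> D ` (B - BK))" if "a \<in> A" for a
  proof -
    have "a \<in> span B" using that spB span_base by blast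
    then have "D a \<in> span (D ` B)" by (simp add: D.span_image)
    moreover have "D ` B \<subseteq> span (B \<union> D ` (B - BK))"
    proof clarify
      fix b assume "b \<in> B"
      show "D b \<in> span (B \<union> D ` (B - BK))"
      proof (cases "b \<in> BK")
        case True
        then have "D b \<in> span B" using BK(2) spB by (auto simp: K_def)
        then show ?thesis using span_mono[of B "B \<union> D ` (B - BK)"] by blast
      qed (use \<open>b \<in> B\<close> in \<open>auto intro: span_base\<close>)
    qed
    ultimately show ?thesis using span_minimal[OF _ subspace_span] by blast
  qed
  moreover have "A \<subseteq> span (B \<union> D ` (B - BK))"
    using span_superset[of A] span_mono[of B "B \<union> D ` (B - BK)"] spB by blast
  ultimately have "span (A \<union> D ` A) \<subseteq> span (B \<union> D ` (B - BK))"
    by (intro span_minimal) auto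
  then have "dim (span (A \<union> D ` A)) \<le> card (B \<union> D ` (B - BK))"
    using fB by (intro dim_le_card) auto
  also have "\<dots> \<le> card B + card (B - BK)"
    by (meson add_left_mono card_Un_le card_image_le fB finite_Diff le_trans)
  finally have le: "dim (span (A \<union> D ` A)) + card BK \<le> 2 * dim (span A)"
    using card_Diff_subset[OF fin(1) B(1)] card_mono[OF fB B(1)] dims by linarith
  then show "dim (span (A \<union> D ` A)) + dim J \<le> 2 * dim (span A)"
    using card_mono[OF fin(1) BK(1)] dims by linarith
  assume "\<exists>v\<in>span A. D v \<in> span A \<and> v \<notin> J"
  then have "BJ \<noteq> BK"
    using BJ(1) BK(4) J(1) span_minimal[of BJ J] by (auto simp: K_def)
  then show "dim (span (A \<union> D ` A)) + dim J < 2 * dim (span A)"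
    using psubset_card_mono[OF fin(1), of BJ] BK(1) le dims by (simp add: psubset_eq)
qed

text \<open>The dimension increments of the filtration are nonincreasing, hence eventually constant, and a
  vector violating the conclusion would make the next increment strictly smaller.\<close>

lemma krylov_stabilizes:
  assumes D: "Vector_Spaces.linear scale scale D" and S0: "finite (S 0)"
    and S: "\<And>n. S (Suc n) = S n \<union> D ` S n"
  obtains N where
    "\<And>n v. N \<le> n \<Longrightarrow> v \<in> span (S (Suc n)) \<Longrightarrow> D v \<in> span (S (Suc n)) \<Longrightarrow> v \<in> span (S n)"
proof -
  interpret D: Vector_Spaces.linear scale scale D by (rule D)
  have fin: "finite (S n)" for n by (induction n) (auto simp: S0 S)
  have sub: "span (S n) \<subseteq> span (S (Suc n))" for n by (intro span_mono) (auto simp: S)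
  have Dsub: "D ` span (S n) \<subseteq> span (S (Suc n))" for n
    by (subst D.span_image[symmetric], intro span_mono) (auto simp: S)
  define d where "d n = int (dim (span (S (Suc n)))) - int (dim (span (S n)))" for n
  note step = dim_span_Un_image_le[OF D fin subspace_span sub Dsub, folded S]
  \<comment> \<open>\<open>dim\<close> has the default value 0 in infinite dimension, so
    monotonicity rests on the finiteness of \<open>S (Suc n)\<close>.\<close>
  have mono: "dim (span (S n)) \<le> dim (span (S (Suc n)))" for n
  proof -
    obtain B where B: "B \<subseteq> span (S n)" "independent B" "card B = dim (span (S n))"
      by (metis basis_exists)
    obtain C where C: "B \<subseteq> C" "C \<subseteq> span (S (Suc n))" "independent C" "span (S (Suc n)) \<subseteq> span C"
      using maximal_independent_subset_extend[OF _ B(2), of "span (S (Suc n))"] B(1) sub[of n] by blast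
    then have "finite C" "card C = dim (span (S (Suc n)))"
      using independent_span_bound[OF fin C(3,2)] basis_card_eq_dim by auto
    then show ?thesis using card_mono[OF _ C(1)] B(3) by simp
  qed
  have d0: "d n \<ge> 0" for n using mono[of n] by (simp add: d_def)
  have dec: "d (Suc n) \<le> d n" for n using step(1)[of n] by (simp add: d_def)
  have anti: "d m \<le> d n" if "n \<le> m" for m n using that dec by (rule lift_Suc_antimono_le[of d, rotated])
  obtain N where N: "\<And>n. nat (d N) \<le> nat (d n)"
    using ex_has_least_nat[of "\<lambda>_. True" _ "\<lambda>n. nat (d n)"] by auto
  have const: "d (Suc n) = d n" if "N \<le> n" for n
    using N[of n] N[of "Suc n"] anti[OF that] anti[of N "Suc n"] that d0[of n] d0[of "Suc n"] d0[of N] by simp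
  show thesis
  proof (rule that, rule ccontr)
    fix n v assume *: "N \<le> n" "v \<in> span (S (Suc n))" "D v \<in> span (S (Suc n))" "v \<notin> span (S n)"
    then have "dim (span (S (Suc (Suc n)))) + dim (span (S n)) < 2 * dim (span (S (Suc n)))"
      by (intro step(2)) auto
    with const[OF *(1)] show False by (simp add: d_def)
  qed
qed

text \<open>Modulo any stage of a filtration containing \<open>F\<close>, the step from
  \<open>u n\<close> to \<open>u (Suc n)\<close> is \<open>D\<close> itself. Beyond the
  stabilization index it raises the level by exactly one, so the vectors of a late tail have
  distinct levels and no nonzero combination of them falls into a lower stage.\<close>

theorem no_perturbed_orbit_with_spanning_tails:
  assumes D: "Vector_Spaces.linear scale scale D" and F: "finite F"
    and u: "\<And>n. u (Suc n) - D (u n) \<in> span F"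
    and tails: "\<And>k. span (u ` {k..}) = UNIV"
    and inf: "\<And>A. finite A \<Longrightarrow> span A \<noteq> UNIV"
  shows False
proof -
  interpret D: Vector_Spaces.linear scale scale D by (rule D)
  obtain e :: 'b where e: "e \<noteq> 0" using inf[OF finite.emptyI] unfolding span_empty by blast
  \<comment> \<open>Each starting vector has a task: \<open>F\<close> puts the perturbations into
    every stage, \<open>u 0\<close> makes \<open>u n\<close> lie in stage \<open>n\<close>, and the
    nonzero \<open>e\<close>, lying in every stage, will be the vector that some tail cannot
    span.\<close>
  define S where "S = rec_nat (insert e (insert (u 0) F)) (\<lambda>_ A. A \<union> D ` A)"
  have S0: "S 0 = insert e (insert (u 0) F)" and S: "S (Suc n) = S n \<union> D ` S n" for n
    by (auto simp: S_def)
  have "finite (S 0)" by (simp add: S0 F)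
  from krylov_stabilizes[of D S, OF D this S] obtain N where
    N: "\<And>n v. N \<le> n \<Longrightarrow> v \<in> span (S (Suc n)) \<Longrightarrow> D v \<in> span (S (Suc n)) \<Longrightarrow> v \<in> span (S n)"
    by blast
  have fin: "finite (S n)" for n by (induction n) (auto simp: S0 S F)
  have subS: "span (S m) \<subseteq> span (S n)" if "m \<le> n" for m n
    by (rule span_mono) (use that S in \<open>auto intro: lift_Suc_mono_le[of S, THEN subsetD]\<close>)
  have DS: "D v \<in> span (S (Suc n))" if "v \<in> span (S n)" for v n
  proof -
    have "D v \<in> span (D ` S n)" using that by (simp add: D.span_image)
    then show ?thesis using span_mono[of "D ` S n" "S (Suc n)"] S by blast
  qed
  have FS: "span F \<subseteq> span (S n)" for n
    using subS[of 0 n] span_mono[of F "S 0"] S0 by blast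
  have uSuc: "u (Suc n) \<in> span (S m) \<longleftrightarrow> D (u n) \<in> span (S m)" for n m
    using u[of n] FS[of m] span_add[of "u (Suc n) - D (u n)" "S m" "D (u n)"]
      span_diff[of "u (Suc n)" "S m" "u (Suc n) - D (u n)"] by auto
  have mem: "u n \<in> span (S n)" for n
    by (induction n) (auto simp: uSuc DS, simp add: S0 span_base)
  have "\<exists>m. u m \<notin> span (S N)"
  proof (rule ccontr)
    assume "\<not> ?thesis"
    then have "span (u ` {0..}) \<subseteq> span (S N)" by (intro span_minimal) auto
    with tails[of 0] inf[OF fin[of N]] show False by (simp add: top.extremum_unique)
  qed
  then obtain m where m: "u m \<notin> span (S N)" by blast
  \<comment> \<open>\<open>l\<close> is the level of \<open>u m\<close>. Since it exceeds
    \<open>N\<close>, its predecessor \<open>p\<close> is at least \<open>N\<close>, so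
    stabilization applies from stage \<open>p\<close> on.\<close>
  define l where "l = (LEAST l. u m \<in> span (S l))"
  have l: "u m \<in> span (S l)" unfolding l_def by (rule LeastI[of _ m]) (rule mem)
  have "N < l" using m l subS[of l N] by (meson linorder_not_less subsetD)
  then obtain p where p: "l = Suc p" "N \<le> p" by (cases l) auto
  have up: "u m \<notin> span (S p)" using not_less_Least[of p "\<lambda>l. u m \<in> span (S l)"] p l_def by auto
  \<comment> \<open>If \<open>u (m + Suc j)\<close> were in stage \<open>Suc (p + j)\<close>, so
    would be \<open>D (u (m + j))\<close>, and stabilization would push \<open>u (m + j)\<close>
    down to stage \<open>p + j\<close>, against the induction hypothesis.\<close>
  have level: "u (m + j) \<in> span (S (Suc (p + j))) \<and> u (m + j) \<notin> span (S (p + j))" for j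
  proof (induction j)
    case (Suc j)
    then show ?case using uSuc[of "m + j"] DS[of "u (m + j)" "Suc (p + j)"] N[of "p + j" "u (m + j)"] p(2)
      by auto
  qed (use l p up in auto)
  \<comment> \<open>In the step, \<open>x\<close> and all earlier vectors are in stage
    \<open>p + j\<close> but \<open>u (m + j)\<close> is not, so its coefficient \<open>c\<close> is
    0 and the block shortens.\<close>
  have triv: "x = 0" if "x \<in> span (u ` {m..<m + j})" "x \<in> span (S p)" for x j
    using that
  proof (induction j)
    case (Suc j)
    have "u ` {m..<m + Suc j} = insert (u (m + j)) (u ` {m..<m + j})"
      by (auto simp: atLeastLessThanSuc)
    then obtain c where c: "x - scale c (u (m + j)) \<in> span (u ` {m..<m + j})"
      using Suc.prems(1) by (auto simp: span_insert)
    have "u ` {m..<m + j} \<subseteq> span (S (p + j))"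
    proof clarsimp
      fix i assume i: "m \<le> i" "i < m + j"
      then have "Suc (p + (i - m)) \<le> p + j" by linarith
      then show "u i \<in> span (S (p + j))"
        using level[of "i - m"] subS i(1) by auto
    qed
    then have "x - scale c (u (m + j)) \<in> span (S (p + j))"
      using c span_minimal[OF _ subspace_span] by blast
    moreover have "x \<in> span (S (p + j))" using Suc.prems(2) subS[of p "p + j"] by auto
    ultimately have "scale c (u (m + j)) \<in> span (S (p + j))"
      using span_diff[of x "S (p + j)" "x - scale c (u (m + j))"] by simp
    then have "c = 0"
      using level[of j] span_scale[of "scale c (u (m + j))" "S (p + j)" "inverse c"] by (cases "c = 0") auto
    then show ?case using c Suc.IH Suc.prems(2) by simp
  qed simp
  \<comment> \<open>The span of the infinite tail is exhausted by spans of finite blocks, to which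
    \<open>triv\<close> applies; it will be used on \<open>e\<close>.\<close>
  define H where "H = (\<Union>j. span (u ` {m..<m + j}))"
  have chain: "span (u ` {m..<m + i}) \<subseteq> span (u ` {m..<m + j})" if "i \<le> j" for i j
    by (rule span_mono) (use that in auto)
  have "subspace H"
  proof (rule subspaceI)
    fix x y assume "x \<in> H" "y \<in> H"
    then obtain i j where "x \<in> span (u ` {m..<m + i})" "y \<in> span (u ` {m..<m + j})" by (auto simp: H_def)
    then have "x + y \<in> span (u ` {m..<m + max i j})"
      using chain[of i "max i j"] chain[of j "max i j"] by (intro span_add) auto
    then show "x + y \<in> H" unfolding H_def by blast
  qed (auto simp: H_def span_zero intro: span_scale)
  moreover have "u ` {m..} \<subseteq> H"
  proof clarify
    fix i assume "m \<le> i"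
    then have "u i \<in> span (u ` {m..<m + Suc (i - m)})" by (intro span_base) auto
    then show "u i \<in> H" unfolding H_def by blast
  qed
  ultimately have "e \<in> H" using span_minimal tails[of m] by blast
  moreover have "e \<in> span (S p)" using subS[of 0 p] S0 span_base[of e "S 0"] by auto
  ultimately show False using triv e by (auto simp: H_def)
qed

end

section \<open>The topology of phi and the continuity of linear maps out of it\<close>

text \<open>Since \<open>phi_topology\<close> is a supremum of locally convex topologies, a set is
  open in it once it is open in one of them. The metric topology of a norm \<open>p\<close> is such
  a topology, and its balls supply the open sets used later.\<close>

lemma locally_convex_space_of_norm:
  fixes s :: "'k::real_normed_field \<Rightarrow> 'a::ab_group_add \<Rightarrow> 'a" and p :: "'a \<Rightarrow> real"
  assumes vs: "vector_space s" and nontriv: "\<exists>x::'a. x \<noteq> 0"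
    and tri: "\<And>x y. p (x + y) \<le> p x + p y"
    and hom: "\<And>c x. p (s c x) = norm c * p x"
    and pos: "\<And>x. p x = 0 \<Longrightarrow> x = 0"
  shows "\<exists>S. locally_convex_space s S \<and> (\<forall>x r. openin S {y. p (y - x) < r})"
proof -
  interpret vector_space s by (rule vs)
  have p0: "p 0 = 0" using hom[of 0 0] by simp
  have pm: "p (- x) = p x" for x using hom[of "-1" x] by simp
  have pd: "p (x - y) = p (y - x)" for x y using pm[of "x - y"] by simp
  have nn: "0 \<le> p x" for x using tri[of x "- x"] by (simp add: p0 pm)
  interpret Metric_space UNIV "\<lambda>x y. p (x - y)"
  proof
    show "p (x - y) = 0 \<longleftrightarrow> x = y" for x y using pos[of "x - y"] p0 by auto
    show "p (x - z) \<le> p (x - y) + p (y - z)" for x y z using tri[of "x - y" "y - z"] by simp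
  qed (auto simp: nn pd)
  have tvs: "topological_vector_space s mtopology"
  proof (intro topological_vector_space.intro topological_vector_space_axioms.intro vs nontriv
      Hausdorff_space_mtopology topspace_mtopology)
    show "continuous_map (prod_topology mtopology mtopology) mtopology (\<lambda>(x, y). x + y)"
      unfolding continuous_map_to_metric
    proof (clarsimp, rename_tac x y e)
      fix x y :: 'a and e :: real assume e: "0 < e"
      have "p (x + y - (x' + y')) < e" if "p (x - x') < e / 2" "p (y - y') < e / 2" for x' y'
      proof -
        have "x + y - (x' + y') = (x - x') + (y - y')" by simp
        then have "p (x + y - (x' + y')) \<le> p (x - x') + p (y - y')" using tri by metis
        then show ?thesis using that by linarith
      qed
      then show "\<exists>U. openin (prod_topology mtopology mtopology) U \<and> (x, y) \<in> U \<and>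
                    (\<forall>z\<in>U. p (x + y - (case z of (x, y) \<Rightarrow> x + y)) < e)"
        using e p0 by (intro exI[of _ "mball x (e/2) \<times> mball y (e/2)"]) (auto simp: openin_prod_Times_iff)
    qed
    show "continuous_map (prod_topology euclidean mtopology) mtopology (\<lambda>(c, x). s c x)"
      unfolding continuous_map_to_metric
    proof (clarsimp, rename_tac c x e)
      fix c :: 'k and x :: 'a and e :: real assume e: "0 < e"
      \<comment> \<open>\<open>K\<close> exceeds \<open>norm c + p x + 1\<close> by 1 to make the
        final estimate strict; \<delta> \<le> 1 is what bounds \<open>p x'\<close> by
        \<open>p x + 1\<close>.\<close>
      define K where "K = norm c + p x + 2"
      define \<delta> where "\<delta> = min 1 (e / K)"
      have K: "0 < K" using nn[of x] by (simp add: K_def add_nonneg_pos)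
      then have \<delta>: "0 < \<delta>" "\<delta> \<le> 1" "\<delta> * K \<le> e" using e by (auto simp: \<delta>_def min_def field_simps)
      have "p (s c x - s c' x') < e" if "dist c c' < \<delta>" "p (x - x') < \<delta>" for c' x'
      proof -
        have "s c x - s c' x' = s c (x - x') + s (c - c') x'"
          by (simp add: scale_left_diff_distrib scale_right_diff_distrib)
        then have "p (s c x - s c' x') \<le> norm c * p (x - x') + dist c c' * p x'"
          using tri[of "s c (x - x')" "s (c - c') x'"] by (simp add: hom dist_norm)
        also have "\<dots> \<le> norm c * \<delta> + \<delta> * p x'"
          using that nn \<delta>(1) by (intro add_mono mult_mono) auto
        also have "p x' \<le> p x + 1" using tri[of "x' - x" x] that(2) \<delta>(2) pd[of x x'] by simp
        also have "norm c * \<delta> + \<delta> * (p x + 1) < \<delta> * K"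
          using \<delta>(1) by (simp add: K_def algebra_simps)
        finally show ?thesis using \<delta> by simp
      qed
      then show "\<exists>U. openin (prod_topology euclidean mtopology) U \<and> (c, x) \<in> U \<and>
                    (\<forall>z\<in>U. p (s c x - (case z of (c, x) \<Rightarrow> s c x)) < e)"
        using \<delta>(1) p0 by (intro exI[of _ "ball c \<delta> \<times> mball x \<delta>"]) (auto simp: openin_prod_Times_iff)
    qed
  qed
  have ball: "{y. p (y - x) < r} = mball x r" for x r by (auto simp: pd)
  have "locally_convex_space s mtopology"
  proof (intro locally_convex_space.intro tvs locally_convex_space_axioms.intro)
    fix U assume "openin mtopology U" "0 \<in> U"
    then obtain r where r: "r > 0" "mball 0 r \<subseteq> U" by (auto simp: openin_mtopology)
    have "convex_set s (mball 0 r)"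
      unfolding convex_set_def
    proof (clarsimp simp: pm)
      fix x y and t :: real assume *: "p x < r" "p y < r" "0 \<le> t" "t \<le> 1"
      have n: "norm (1 - of_real t :: 'k) = 1 - t"
        using *(3,4) by (metis abs_of_nonneg diff_ge_0_iff_ge norm_of_real of_real_1 of_real_diff)
      have "p (- s (1 - of_real t) x - s (of_real t) y) = p (s (1 - of_real t) x + s (of_real t) y)"
        using pm[of "s (1 - of_real t) x + s (of_real t) y"] by simp
      also have "\<dots> \<le> (1 - t) * p x + t * p y"
        using tri[of "s (1 - of_real t) x" "s (of_real t) y"] *(3) n by (simp add: hom)
      also have "\<dots> < r" using convex_bound_lt[OF *(1,2), of "1 - t" t] *(3,4) by simp
      finally show "p (- s (1 - of_real t) x - s (of_real t) y) < r" .
    qed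
    then show "\<exists>V. openin mtopology V \<and> 0 \<in> V \<and> V \<subseteq> U \<and> convex_set s V"
      using r p0 by (intro exI[of _ "mball 0 r"]) auto
  qed
  then show ?thesis using ball openin_mball by metis
qed

lemma phi_expand: "f = (\<Sum>n\<in>Poly_Mapping.keys f. phi_scale (Poly_Mapping.lookup f n) (Poly_Mapping.single n 1))"
proof (rule poly_mapping_eqI)
  fix k
  have "(\<Sum>n\<in>Poly_Mapping.keys f. Poly_Mapping.lookup f n * (1 when n = k)) =
      (\<Sum>n\<in>Poly_Mapping.keys f. if n = k then Poly_Mapping.lookup f n else 0)"
    by (rule sum.cong) (auto simp: when_def)
  then show "Poly_Mapping.lookup f k = Poly_Mapping.lookup
      (\<Sum>n\<in>Poly_Mapping.keys f. phi_scale (Poly_Mapping.lookup f n) (Poly_Mapping.single n 1)) k"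
    by (simp add: lookup_sum lookup_single in_keys_iff)
qed

text \<open>\<open>U\<close> is a unit ball of the weighted sum norm with weights
  \<open>1 / w n\<close>: finite supports keep the sum finite however fast \<open>w\<close> decays,
  and no single term exceeds the sum.\<close>

lemma openin_phi_weighted_ball:
  fixes w :: "nat \<Rightarrow> real"
  assumes w: "\<And>n. 0 < w n"
  obtains U :: "(nat \<Rightarrow>\<^sub>0 'k::real_normed_field) set" where "openin phi_topology U" "x \<in> U"
    "\<And>y n. y \<in> U \<Longrightarrow> norm (Poly_Mapping.lookup (y - x) n) < w n"
proof -
  define p :: "(nat \<Rightarrow>\<^sub>0 'k) \<Rightarrow> real"
    where "p f = (\<Sum>n\<in>Poly_Mapping.keys f. norm (Poly_Mapping.lookup f n) / w n)" for f
  \<comment> \<open>The supports of \<open>x\<close>, \<open>y\<close> and \<open>x + y\<close>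
    differ; over a common larger index set the sums can be compared term by term.\<close>
  have p_eq: "p f = (\<Sum>n\<in>A. norm (Poly_Mapping.lookup f n) / w n)"
    if "finite A" "Poly_Mapping.keys f \<subseteq> A" for f A
    unfolding p_def by (rule sum.mono_neutral_left) (use that in \<open>auto simp: in_keys_iff\<close>)
  have coord: "norm (Poly_Mapping.lookup f n) / w n \<le> p f" for f n
  proof (cases "n \<in> Poly_Mapping.keys f")
    case True
    then show ?thesis unfolding p_def
      using w by (intro member_le_sum) (auto simp: less_imp_le)
  next
    case False
    then show ?thesis unfolding p_def using w by (auto simp: in_keys_iff less_imp_le intro!: sum_nonneg)
  qed
  have "\<exists>S. locally_convex_space phi_scale S \<and> (\<forall>x r. openin S {y. p (y - x) < r})"
  proof (rule locally_convex_space_of_norm)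
    show "vector_space (phi_scale :: 'k \<Rightarrow> _)" by (rule vector_space_phi)
    show "\<exists>x :: nat \<Rightarrow>\<^sub>0 'k. x \<noteq> 0" by (metis lookup_single_eq lookup_zero zero_neq_one)
    fix x y :: "nat \<Rightarrow>\<^sub>0 'k"
    let ?A = "Poly_Mapping.keys x \<union> Poly_Mapping.keys y"
    show "p (x + y) \<le> p x + p y"
      using w keys_add[of x y]
      by (subst (1 2 3) p_eq[of ?A])
        (auto simp: lookup_add sum.distrib[symmetric] add_divide_distrib[symmetric] less_imp_le
          intro!: sum_mono divide_right_mono norm_triangle_ineq)
  next
    fix c :: 'k and x
    show "p (phi_scale c x) = norm c * p x"
      by (subst (1 2) p_eq[of "Poly_Mapping.keys x"])
        (auto simp: in_keys_iff norm_mult sum_distrib_left)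
  next
    fix x assume "p x = 0"
    then have "Poly_Mapping.lookup x n = 0" for n
      using coord[of x n] w[of n] by (simp add: divide_le_0_iff)
    then show "x = 0" by (intro poly_mapping_eqI) simp
  qed
  then have "openin phi_topology {y. p (y - x) < 1}" using openin_phi_topology by blast
  moreover have "norm (Poly_Mapping.lookup (y - x) n) < w n" if "p (y - x) < 1" for y n
    using le_less_trans[OF coord that] w by (simp add: divide_less_eq)
  moreover have "p (x - x) < 1" by (simp add: p_def)
  ultimately show thesis by (intro that[of "{y. p (y - x) < 1}"]) auto
qed

context topological_vector_space
begin

lemma open_translate: "openin T U \<Longrightarrow> openin T {y. a + y \<in> U}"
proof -
  assume U: "openin T U"
  have "continuous_map T (prod_topology T T) (\<lambda>y. (a, y))"
    by (intro continuous_map_pairedI) (auto simp: topspace_eq)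
  from continuous_map_compose[OF this continuous_add]
  have "continuous_map T T (\<lambda>y. a + y)" by (simp add: o_def)
  from openin_continuous_map_preimage[OF this U] show ?thesis by (simp add: topspace_eq)
qed

lemma nhd_half:
  assumes "openin T U" "0 \<in> U"
  obtains V where "openin T V" "0 \<in> V" "\<And>x y. x \<in> V \<Longrightarrow> y \<in> V \<Longrightarrow> x + y \<in> U"
proof -
  have "openin (prod_topology T T) {z \<in> topspace (prod_topology T T). (case z of (x, y) \<Rightarrow> x + y) \<in> U}"
    by (rule openin_continuous_map_preimage[OF continuous_add assms(1)])
  moreover have "(0, 0) \<in> {z \<in> topspace (prod_topology T T). (case z of (x, y) \<Rightarrow> x + y) \<in> U}"
    using assms(2) by (simp add: topspace_eq)
  ultimately have "\<exists>A B. openin T A \<and> openin T B \<and> 0 \<in> A \<and> 0 \<in> B \<and>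
    A \<times> B \<subseteq> {z \<in> topspace (prod_topology T T). (case z of (x, y) \<Rightarrow> x + y) \<in> U}"
    unfolding openin_prod_topology_alt by simp
  then obtain A B where "openin T A" "openin T B" "0 \<in> A" "0 \<in> B"
    "A \<times> B \<subseteq> {z \<in> topspace (prod_topology T T). (case z of (x, y) \<Rightarrow> x + y) \<in> U}"
    by blast
  then show thesis by (intro that[of "A \<inter> B"]) auto
qed

lemma nhd_absorbs:
  assumes "openin T U" "0 \<in> U"
  obtains e :: real where "0 < e" "\<And>c. norm c < e \<Longrightarrow> s c x \<in> U"
proof -
  have "continuous_map euclidean (prod_topology euclidean T) (\<lambda>c. (c, x))"
    by (intro continuous_map_pairedI) (auto simp: topspace_eq)
  from continuous_map_compose[OF this continuous_scale]
  have "continuous_map euclidean T (\<lambda>c. s c x)" by (simp add: o_def)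
  from openin_continuous_map_preimage[OF this assms(1)] have "open {c. s c x \<in> U}" by simp
  moreover have "0 \<in> {c. s c x \<in> U}" using assms(2) by simp
  ultimately obtain e where "0 < e" "ball 0 e \<subseteq> {c. s c x \<in> U}"
    by (rule openE)
  then show thesis by (intro that[of e]) auto
qed

text \<open>Local convexity of the target is not needed: a nested sequence with
  \<open>W\<^sub>n\<^sub>+\<^sub>1 + W\<^sub>n\<^sub>+\<^sub>1 \<subseteq> W\<^sub>n\<close> absorbs all finite sums of vectors taken one from each term, and the
  weights of the ball in \<open>\<phi>\<close> put the image of the \<open>n\<close>-th coordinate into \<open>W\<^sub>n\<^sub>+\<^sub>1\<close>.\<close>

lemma continuous_linear_phi:
  assumes L: "Vector_Spaces.linear phi_scale s L"
  shows "continuous_map phi_topology T L"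
proof -
  interpret L: Vector_Spaces.linear phi_scale s L by (rule L)
  interpret phi: locally_convex_space phi_scale "phi_topology :: (nat \<Rightarrow>\<^sub>0 'k) topology"
    by (rule locally_convex_space_phi)
  have *: "\<exists>V. openin phi_topology V \<and> x \<in> V \<and> V \<subseteq> {y. L y \<in> U}" if U: "openin T U" "L x \<in> U" for U x
  proof -
    define U' where "U' = {y. L x + y \<in> U}"
    have U': "openin T U'" "0 \<in> U'" using open_translate[OF U(1)] U(2) by (auto simp: U'_def)
    have "\<exists>V. openin T V \<and> 0 \<in> V \<and> (\<forall>x\<in>V. \<forall>y\<in>V. x + y \<in> A)" if "openin T A \<and> 0 \<in> A" for A
      using nhd_half[of A] that by metis
    then obtain H where H: "openin T (H A) \<and> 0 \<in> H A \<and> (\<forall>x\<in>H A. \<forall>y\<in>H A. x + y \<in> A)"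
      if "openin T A \<and> 0 \<in> A" for A
      by metis
    define W where "W n = (H ^^ n) U'" for n
    have W: "openin T (W n) \<and> 0 \<in> W n" for n
      by (induction n) (use U' H in \<open>auto simp: W_def\<close>)
    have WW: "x + y \<in> W n" if "x \<in> W (Suc n)" "y \<in> W (Suc n)" for n x y
      using H[OF W] that by (auto simp: W_def)
    \<comment> \<open>The index shift matters: the first term \<open>v n\<close> and, by induction,
      the remaining sum both lie in \<open>W (Suc n)\<close>, so together they lie in
      \<open>W n\<close>.\<close>
    have tail: "(\<Sum>i<m. v (n + i)) \<in> W n" if v: "\<And>i. v i \<in> W (Suc i)" for v :: "nat \<Rightarrow> 'a" and m n
    proof (induction m arbitrary: n)
      case (Suc m)
      then show ?case using WW[OF v Suc.IH[of "Suc n"]] by (simp add: sum.lessThan_Suc_shift del: sum.lessThan_Suc)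
    qed (simp add: W)
    have "\<exists>e>0. \<forall>c. norm c < e \<longrightarrow> s c (L (Poly_Mapping.single n 1)) \<in> W (Suc n)" for n
      using nhd_absorbs[of "W (Suc n)"] W by metis
    then obtain e where e: "\<And>n. 0 < e n"
      "\<And>n c. norm c < e n \<Longrightarrow> s c (L (Poly_Mapping.single n 1)) \<in> W (Suc n)"
      by metis
    obtain V where V: "openin phi_topology V" "x \<in> V"
      "\<And>y n. y \<in> V \<Longrightarrow> norm (Poly_Mapping.lookup (y - x) n) < e n"
      using openin_phi_weighted_ball[of e x] e(1) by blast
    have "L y \<in> U" if y: "y \<in> V" for y
    proof -
      let ?v = "\<lambda>n. s (Poly_Mapping.lookup (y - x) n) (L (Poly_Mapping.single n 1))"
      obtain m where m: "Poly_Mapping.keys (y - x) \<subseteq> {..<m}"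
        using finite_nat_iff_bounded[of "Poly_Mapping.keys (y - x)"] by auto
      have "L (y - x) = (\<Sum>n\<in>Poly_Mapping.keys (y - x). ?v n)"
        by (subst phi_expand) (simp add: L.sum L.scale)
      also have "\<dots> = (\<Sum>n<m. ?v n)"
        by (rule sum.mono_neutral_left) (use m in \<open>auto simp: in_keys_iff\<close>)
      also have "\<dots> \<in> W 0" using tail[of ?v 0 m] e(2) V(3)[OF y] by simp
      finally show ?thesis by (simp add: W_def U'_def L.diff)
    qed
    then show ?thesis using V by blast
  qed
  have "openin phi_topology {x. L x \<in> U}" if "openin T U" for U
    unfolding openin_subopen[of phi_topology "{x. L x \<in> U}"] using * that by blast
  then show ?thesis by (auto simp: continuous_map_def topspace_eq phi.topspace_eq)
qed

end

section \<open>Quotients isomorphic to phi and maps of finite rank\<close>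

context topological_vector_space
begin

text \<open>A linear right inverse \<open>R\<close> of \<open>Q\<close> is automatically continuous,
  because its domain is phi. Followed by the quotient map, it is a continuous inverse of the
  bijection that \<open>Q\<close> induces on the quotient by its kernel.\<close>

lemma has_quotient_phi_if_surj:
  assumes Q: "Vector_Spaces.linear s phi_scale Q" and cont: "continuous_map T phi_topology Q"
    and surj: "surj Q"
  shows "has_quotient_isomorphic_to s T phi_scale phi_topology"
proof -
  interpret Q: Vector_Spaces.linear s phi_scale Q by (rule Q)
  interpret phi: locally_convex_space phi_scale "phi_topology :: (nat \<Rightarrow>\<^sub>0 'k) topology"
    by (rule locally_convex_space_phi)
  interpret vector_space_pair s "phi_scale :: 'k \<Rightarrow> _" ..
  define Y where "Y = {x. Q x = 0}"
  have coset: "left_coset Y x = {z. Q z = Q x}" for x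
    unfolding left_coset_def Y_def
    by (auto simp: Q.add Q.diff intro: exI[of _ "_ - x"])
  \<comment> \<open>The cosets of the kernel are the fibres of \<open>Q\<close>, so \<open>Q\<close>
    maps each of them to a singleton.\<close>
  define h where "h A = the_elem (Q ` A)" for A
  have h: "h {z. Q z = y} = y" for y
  proof -
    have "Q ` {z. Q z = y} = {y}" using surj by (auto simp: surj_def image_iff) metis
    then show ?thesis by (simp add: h_def)
  qed
  obtain R where R: "Vector_Spaces.linear phi_scale s R" "Q \<circ> R = id"
    using linear_surjective_right_inverse[OF Q surj] by blast
  have QR: "Q (R y) = y" for y using R(2) by (simp add: fun_eq_iff)
  note qm = quotient_map_left_coset[OF topspace_eq, of Y]
  have top: "topspace (quotient_topology T Y) = quotient_carrier Y"
    using quotient_imp_surjective_map[OF qm] by (simp add: topspace_eq quotient_carrier_def)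
  have "homeomorphic_maps (quotient_topology T Y) phi_topology h (left_coset Y \<circ> R)"
    unfolding homeomorphic_maps_def
  proof (intro conjI ballI)
    show "continuous_map (quotient_topology T Y) phi_topology h"
      by (rule continuous_compose_quotient_map[OF qm]) (simp add: o_def coset h cont)
    show "continuous_map phi_topology (quotient_topology T Y) (left_coset Y \<circ> R)"
      by (rule continuous_map_compose[OF continuous_linear_phi[OF R(1)] quotient_imp_continuous_map[OF qm]])
    show "h ((left_coset Y \<circ> R) y) = y" for y
      by (simp add: coset h QR)
    show "(left_coset Y \<circ> R) (h A) = A" if "A \<in> topspace (quotient_topology T Y)" for A
      using that by (auto simp: top quotient_carrier_def coset h QR)
  qed
  then have hom: "homeomorphic_map (quotient_topology T Y) phi_topology h"
    using homeomorphic_map_maps by blast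
  have add: "quotient_add {z. Q z = Q x} {z. Q z = Q y} = {z. Q z = Q (x + y)}" for x y
  proof -
    have "\<exists>a b. z = a + b \<and> Q a = Q x \<and> Q b = Q y" if "Q z = Q (x + y)" for z
      by (rule exI[of _ x], rule exI[of _ "z - x"]) (simp add: that Q.add Q.diff)
    then show ?thesis by (auto simp: quotient_add_def Q.add)
  qed
  have scale: "quotient_scale s Y c {z. Q z = Q x} = {z. Q z = Q (s c x)}" for c x
  proof -
    have "\<exists>a y. z = s c a + y \<and> Q a = Q x \<and> Q y = 0" if "Q z = Q (s c x)" for z
      by (rule exI[of _ x], rule exI[of _ "z - s c x"]) (simp add: that Q.diff)
    then show ?thesis by (auto simp: quotient_scale_def Y_def Q.add Q.scale)
  qed
  have "quotient_isomorphic s T Y phi_scale phi_topology"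
    unfolding quotient_isomorphic_def
    by (rule exI[of _ h]) (auto simp: hom quotient_carrier_def coset add scale h Q.add Q.scale)
  moreover have "subspace Y" by (rule subspaceI) (auto simp: Y_def Q.add Q.scale)
  moreover have "closedin T Y"
  proof -
    have "closedin phi_topology {0 :: nat \<Rightarrow>\<^sub>0 'k}"
      by (rule closedin_Hausdorff_singleton[OF phi.hausdorff]) (simp add: phi.topspace_eq)
    from closedin_continuous_map_preimage[OF cont this] show ?thesis by (simp add: topspace_eq Y_def)
  qed
  ultimately show ?thesis unfolding has_quotient_isomorphic_to_def by blast
qed

end

lemma span_phi_units:
  "module.span phi_scale (range (\<lambda>n. Poly_Mapping.single n (1::'k::real_normed_field))) = UNIV"
proof -
  interpret phi: vector_space "phi_scale :: 'k \<Rightarrow> _" by (rule vector_space_phi)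
  have "f \<in> phi.span (range (\<lambda>n. Poly_Mapping.single n 1))" for f
    by (subst phi_expand) (intro phi.span_sum phi.span_scale phi.span_base rangeI)
  then show ?thesis by blast
qed

lemma phi_not_finite_dimensional:
  fixes A :: "(nat \<Rightarrow>\<^sub>0 'k::real_normed_field) set"
  assumes "finite A"
  shows "module.span phi_scale A \<noteq> UNIV"
proof -
  interpret phi: vector_space "phi_scale :: 'k \<Rightarrow> _" by (rule vector_space_phi)
  have "finite (\<Union>(Poly_Mapping.keys ` A))" using assms by simp
  then obtain m where m: "\<Union>(Poly_Mapping.keys ` A) \<subseteq> {..<m}"
    using finite_nat_iff_bounded by metis
  have "phi.span A \<subseteq> {f. Poly_Mapping.lookup f m = 0}"
  proof (rule phi.span_minimal)
    show "A \<subseteq> {f. Poly_Mapping.lookup f m = 0}" using m by (fastforce simp: in_keys_iff)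
  qed (auto intro!: phi.subspaceI simp: lookup_add)
  moreover have "Poly_Mapping.lookup (Poly_Mapping.single m (1::'k)) m \<noteq> 0" by simp
  ultimately show ?thesis by blast
qed

text \<open>An infinite independent sequence \<open>b\<close> in the range of \<open>C\<close> could
  be sent to the unit vectors by a linear endomorphism \<open>g\<close> of phi. As \<open>g\<close>
  is automatically continuous, \<open>g \<circ> C\<close> would be a continuous surjection onto phi
  and yield the excluded quotient.\<close>

lemma finite_rank_into_phi:
  assumes tvs: "topological_vector_space s T"
    and C: "Vector_Spaces.linear s phi_scale C" and cont: "continuous_map T phi_topology C"
    and noq: "\<not> has_quotient_isomorphic_to s T phi_scale phi_topology"
  obtains F where "finite F" "range C \<subseteq> module.span phi_scale F"
proof -
  interpret topological_vector_space s T by (rule tvs)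
  interpret phi: locally_convex_space phi_scale "phi_topology :: (nat \<Rightarrow>\<^sub>0 'a) topology"
    by (rule locally_convex_space_phi)
  interpret C: Vector_Spaces.linear s phi_scale C by (rule C)
  interpret endo: vector_space_pair "phi_scale :: 'a \<Rightarrow> _" "phi_scale :: 'a \<Rightarrow> _" ..
  obtain B where B: "B \<subseteq> range C" "\<not> phi.dependent B" "range C \<subseteq> phi.span B"
    using phi.maximal_independent_subset by blast
  have "finite B"
  proof (rule ccontr)
    assume "infinite B"
    then obtain b :: "nat \<Rightarrow> nat \<Rightarrow>\<^sub>0 'a" where b: "inj b" "range b \<subseteq> B"
      using infinite_countable_subset by blast
    have "\<not> phi.dependent (range b)" using phi.independent_mono B(2) b(2) by blast
    then obtain g where g: "Vector_Spaces.linear phi_scale phi_scale g"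
      "\<forall>x\<in>range b. g x = Poly_Mapping.single (inv b x) (1::'a)"
      using endo.linear_independent_extend[of "range b" "\<lambda>x. Poly_Mapping.single (inv b x) 1"] by blast
    interpret g: Vector_Spaces.linear "phi_scale :: 'a \<Rightarrow> _" phi_scale g by (rule g(1))
    have units: "Poly_Mapping.single n 1 \<in> range (g \<circ> C)" for n
    proof -
      obtain x where "b n = C x" using b(2) B(1) by blast
      then have "(g \<circ> C) x = Poly_Mapping.single n 1"
        using g(2) b(1) by (metis comp_apply inv_f_f rangeI)
      then show ?thesis by (metis rangeI)
    qed
    have lin: "Vector_Spaces.linear s phi_scale (g \<circ> C)"
      by (rule Vector_Spaces.linear_compose[OF C g(1)])
    interpret gC: Vector_Spaces.linear s "phi_scale :: 'a \<Rightarrow> _" "g \<circ> C" by (rule lin)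
    have "phi.span (range (\<lambda>n. Poly_Mapping.single n 1)) \<subseteq> range (g \<circ> C)"
      by (rule phi.span_minimal) (use units gC.subspace_image[OF subspace_UNIV] in auto)
    then have "surj (g \<circ> C)" by (simp add: span_phi_units top.extremum_unique)
    moreover have "continuous_map T phi_topology (g \<circ> C)"
      by (rule continuous_map_compose[OF cont phi.continuous_linear_phi[OF g(1)]])
    ultimately show False using has_quotient_phi_if_surj[OF lin] noq by blast
  qed
  then show thesis using that B(3) by blast
qed

section \<open>Functionals on the product and the conclusion\<close>

text \<open>With the scalar field as target, \<open>continuous_linear_phi\<close> makes every linear
  functional on phi continuous.\<close>

lemma topological_vector_space_field:
  "topological_vector_space ((*) :: 'k::real_normed_field \<Rightarrow> _) euclidean"
proof (intro topological_vector_space.intro topological_vector_space_axioms.intro)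
  show "vector_space ((*) :: 'k \<Rightarrow> _)" by unfold_locales (auto simp: algebra_simps)
  show "\<exists>x::'k. x \<noteq> 0" by (rule exI[of _ 1]) simp
  show "continuous_map (prod_topology euclidean euclidean) euclidean (\<lambda>(x::'k, y). x + y)"
    "continuous_map (prod_topology euclidean euclidean) euclidean (\<lambda>(x::'k, y). x * y)"
    by (auto simp: euclidean_product_topology case_prod_unfold intro!: continuous_intros)
qed (auto simp: Hausdorff_space_euclidean)

lemma vanishes_on_dense:
  fixes g :: "'a \<Rightarrow> 'k::real_normed_field"
  assumes "continuous_map X euclidean g" "X closure_of S = topspace X" "\<And>x. x \<in> S \<Longrightarrow> g x = 0"
    and "x \<in> topspace X"
  shows "g x = 0"
proof -
  have "closedin X {x \<in> topspace X. g x \<in> {0}}"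
    by (rule closedin_continuous_map_preimage[OF assms(1)]) simp
  then have "X closure_of (topspace X \<inter> S) \<subseteq> {x \<in> topspace X. g x \<in> {0}}"
    by (rule closure_of_minimal[rotated]) (use assms(3) in auto)
  then show ?thesis using assms(2,4) closure_of_restrict[of X S] by auto
qed

theorem no_cyclic_operator_with_dense_range:
  assumes tvs: "topological_vector_space s T"
    and noq: "\<not> has_quotient_isomorphic_to s T phi_scale phi_topology"
    and cyc: "cyclic_operator (prod_scale s phi_scale) (prod_topology T phi_topology) f"
    and dense: "dense_range (prod_topology T phi_topology) f"
  shows False
proof -
  interpret topological_vector_space s T by (rule tvs)
  interpret phi: locally_convex_space phi_scale "phi_topology :: (nat \<Rightarrow>\<^sub>0 'a) topology"
    by (rule locally_convex_space_phi)
  interpret prod: vector_space "prod_scale s (phi_scale :: 'a \<Rightarrow> _)"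
    by (rule vector_space_prod) unfold_locales
  interpret field: topological_vector_space "(*) :: 'a \<Rightarrow> _" euclidean
    by (rule topological_vector_space_field)
  interpret dual: vector_space_pair "phi_scale :: 'a \<Rightarrow> _" "(*) :: 'a \<Rightarrow> _" ..
  let ?Z = "prod_topology T (phi_topology :: (nat \<Rightarrow>\<^sub>0 'a) topology)"
  let ?s = "prod_scale s (phi_scale :: 'a \<Rightarrow> _)"
  have topZ: "topspace ?Z = UNIV" by (simp add: topspace_eq phi.topspace_eq)
  obtain z where f: "Vector_Spaces.linear ?s ?s f" and cont: "continuous_map ?Z ?Z f"
    and z: "?Z closure_of prod.span (range (\<lambda>n. (f ^^ n) z)) = topspace ?Z"
    using cyc unfolding cyclic_operator_def continuous_operator_def by blast
  have dr: "?Z closure_of range f = topspace ?Z" using dense by (simp only: dense_range_def topZ)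
  interpret f: Vector_Spaces.linear ?s ?s f by (rule f)
  define C where "C x = snd (f (x, 0))" for x
  define D where "D y = snd (f (0, y))" for y
  define u where "u n = snd ((f ^^ n) z)" for n
  have C: "Vector_Spaces.linear s phi_scale C"
    unfolding Vector_Spaces.linear_iff
  proof (intro conjI allI)
    show "C (x + y) = C x + C y" for x y using f.add[of "(x, 0)" "(y, 0)"] by (simp add: C_def)
    show "C (s c x) = phi_scale c (C x)" for c x
      using f.scale[of c "(x, 0)"] by (simp add: C_def prod_scale_def case_prod_unfold)
  qed unfold_locales
  have D: "Vector_Spaces.linear phi_scale phi_scale D"
    unfolding Vector_Spaces.linear_iff
  proof (intro conjI allI)
    show "D (x + y) = D x + D y" for x y using f.add[of "(0, x)" "(0, y)"] by (simp add: D_def)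
    show "D (phi_scale c x) = phi_scale c (D x)" for c x
      using f.scale[of c "(0, x)"] by (simp add: D_def prod_scale_def case_prod_unfold)
  qed unfold_locales
  have "continuous_map T ?Z (\<lambda>x. (x, 0))"
    by (intro continuous_map_pairedI) (auto simp: phi.topspace_eq)
  from continuous_map_compose[OF continuous_map_compose[OF this cont] continuous_map_snd]
  have "continuous_map T phi_topology C" by (simp add: o_def C_def[abs_def])
  from finite_rank_into_phi[OF tvs C this noq] obtain F where
    F: "finite F" "range C \<subseteq> phi.span F" by blast
  \<comment> \<open>The perturbation is \<open>C x\<close> with \<open>x\<close> the first component
    of the iterate; nothing is known about \<open>x\<close>, but the range of \<open>C\<close> is
    finite-dimensional.\<close>
  have u: "u (Suc n) - D (u n) \<in> phi.span F" for n
  proof -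
    obtain x y where xy: "(f ^^ n) z = (x, y)" by fastforce
    have "f (x, y) = f (x, 0) + f (0, y)" using f.add[of "(x, 0)" "(0, y)"] by simp
    then have "u (Suc n) - D (u n) = C x" by (simp add: u_def C_def D_def xy)
    then show ?thesis using F(2) by auto
  qed
  \<comment> \<open>For \<open>k = 0\<close> this is cyclicity. If \<open>g\<close> vanishes on the
    iterates from \<open>Suc k\<close> on, then \<open>g \<circ> f\<close> does so from
    \<open>k\<close> on and is 0 by induction; dense range then gives \<open>g = 0\<close>. Hence
    \<open>g\<close> must vary in the induction.\<close>
  have zero: "g x = 0"
    if "continuous_map ?Z euclidean g" "Vector_Spaces.linear ?s ((*) :: 'a \<Rightarrow> _) g"
      "\<And>n. k \<le> n \<Longrightarrow> g ((f ^^ n) z) = 0" for g k x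
    using that
  proof (induction k arbitrary: g x)
    case 0
    interpret g: Vector_Spaces.linear ?s "(*) :: 'a \<Rightarrow> _" g by (rule 0(2))
    have "prod.span (range (\<lambda>n. (f ^^ n) z)) \<subseteq> {x. g x = 0}"
    proof (rule prod.span_minimal)
      show "prod.subspace {x. g x = 0}"
        by (rule prod.subspaceI) (simp_all add: g.add g.scale)
    qed (use 0(3) in auto)
    then have null: "g x = 0" if "x \<in> prod.span (range (\<lambda>n. (f ^^ n) z))" for x using that by blast
    show ?case by (rule vanishes_on_dense[OF 0(1) z null]) (simp_all only: topZ UNIV_I)
  next
    case (Suc k)
    have "(g \<circ> f) x = 0" for x
    proof (rule Suc.IH)
      show "continuous_map ?Z euclidean (g \<circ> f)" by (rule continuous_map_compose[OF cont Suc.prems(1)])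
      show "Vector_Spaces.linear ?s (*) (g \<circ> f)" by (rule Vector_Spaces.linear_compose[OF f Suc.prems(2)])
      show "(g \<circ> f) ((f ^^ n) z) = 0" if "k \<le> n" for n using Suc.prems(3)[of "Suc n"] that by simp
    qed
    then have null: "g x = 0" if "x \<in> range f" for x using that by auto
    show ?case by (rule vanishes_on_dense[OF Suc.prems(1) dr null]) (simp_all only: topZ UNIV_I)
  qed
  have tails: "phi.span (u ` {k..}) = UNIV" for k
  proof (rule ccontr)
    assume "phi.span (u ` {k..}) \<noteq> UNIV"
    then obtain y where y: "y \<notin> phi.span (u ` {k..})" by blast
    obtain B where B: "B \<subseteq> u ` {k..}" "\<not> phi.dependent B" "u ` {k..} \<subseteq> phi.span B"
      using phi.maximal_independent_subset by blast
    have yB: "y \<notin> phi.span B" using y B(1) phi.span_mono by blast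
    then have "\<not> phi.dependent (insert y B)" using B(2) by (rule phi.independent_insertI)
    \<comment> \<open>\<open>g\<close> separates \<open>y\<close> from the span of the tail purely
      algebraically. Its continuity is automatic, so \<open>zero\<close> applies to
      \<open>g \<circ> snd\<close> and contradicts \<open>g y = 1\<close>.\<close>
    then obtain g where g: "Vector_Spaces.linear phi_scale (*) g"
      "\<forall>x\<in>insert y B. g x = (if x = y then 1 else 0)"
      using dual.linear_independent_extend[of "insert y B" "\<lambda>x. if x = y then 1 else 0"] by blast
    interpret g: Vector_Spaces.linear "phi_scale :: 'a \<Rightarrow> _" "(*) :: 'a \<Rightarrow> _" g by (rule g(1))
    have "y \<notin> B" using yB phi.span_base by blast
    then have "phi.span B \<subseteq> {x. g x = 0}"
      by (intro phi.span_minimal) (use g(2) in \<open>auto intro!: phi.subspaceI simp: g.add g.scale\<close>)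
    then have gu: "g (u n) = 0" if "k \<le> n" for n using B(3) that by blast
    have "(g \<circ> snd) (0 :: 'b, y) = 0"
    proof (rule zero[of "g \<circ> snd" k])
      show "continuous_map ?Z euclidean (g \<circ> snd)"
        by (rule continuous_map_compose[OF continuous_map_snd field.continuous_linear_phi[OF g(1)]])
      show "Vector_Spaces.linear ?s (*) (g \<circ> snd)"
        unfolding Vector_Spaces.linear_iff
        by (intro conjI allI prod.vector_space_axioms topological_vector_space.axioms(1)[OF topological_vector_space_field])
          (auto simp: prod_scale_def case_prod_unfold g.add g.scale)
    qed (use gu in \<open>simp add: u_def\<close>)
    with g(2) show False by simp
  qed
  show False
    by (rule phi.no_perturbed_orbit_with_spanning_tails[OF D F(1) u tails phi_not_finite_dimensional])
qed

theorem theorem1p8: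
  fixes scale_real :: "real \<Rightarrow> 'a::ab_group_add \<Rightarrow> 'a" and T_real :: "'a topology"
    and scale_complex :: "complex \<Rightarrow> 'b::ab_group_add \<Rightarrow> 'b" and T_complex :: "'b topology"
  shows
    "(topological_vector_space scale_real T_real \<and>
      \<not> has_quotient_isomorphic_to scale_real T_real phi_scale phi_topology \<longrightarrow>
      \<not> (\<exists>f. cyclic_operator (prod_scale scale_real phi_scale) (prod_topology T_real phi_topology) f \<and>
             dense_range (prod_topology T_real phi_topology) f)) \<and>
     (topological_vector_space scale_complex T_complex \<and>
      \<not> has_quotient_isomorphic_to scale_complex T_complex phi_scale phi_topology \<longrightarrow>
      \<not> (\<exists>f. cyclic_operator (prod_scale scale_complex phi_scale) (prod_topology T_complex phi_topology) f \<and>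
             dense_range (prod_topology T_complex phi_topology) f))"
  using no_cyclic_operator_with_dense_range[of scale_real T_real]
    no_cyclic_operator_with_dense_range[of scale_complex T_complex]
  by blast

end
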